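(* Let $v$ and $v'$ be two points of the lower half-space $F^-$ lying at the same distance from the plane $F$, let $\ell$ be a line in the upper half-space $F^+$ parallel to $F$, and let $C\ge 0$ be a real number. Then the Voronoi cell $$\mathcal{V}(v,v',\ell;C)=\{\mathbf{x}\in\ell\ :\ c(v,\mathbf{x})+C<c(v',\mathbf{x})\}$$ is an interval on $\ell$ -- possibly empty, finite or infinite.
   Context: $F$ is a plane in $\mathbb{R}^3$, and $F^-$ (lower) and $F^+$ (upper) are the two open half-spaces it bounds, with positive weights $w^-$ and $w^+$ respectively. The plane $F$ has a weight $w$ such that $w=\min(w^-,w^+)$ if $w^-\ne w^+$, and $0<w\le w^-=w^+$ if $w^-=w^+$. For $p\in F^-$ and $\mathbf{x}\in F^+$ the weighted distance is $$c(p,\mathbf{x})=\min_{a,a_1\in F}\big(w^-|pa|+w|aa_1|+w^+|a_1\mathbf{x}|\big),$$ where $|\cdot|$ denotes Euclidean length. *)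

theory Defs
  imports "HOL-Analysis.Analysis"
begin

type_synonym point = "real^3"

(* A plane together with a choice of which side is "upper" is given by a normal
   vector n, pointing to the upper side, and an offset d.  The conditions below
   describe a plane and two half-spaces only if n is nonzero. *)

definition plane :: "point \<Rightarrow> real \<Rightarrow> point set" where
  "plane n d = {x. n \<bullet> x = d}"

definition lower :: "point \<Rightarrow> real \<Rightarrow> point set" where
  "lower n d = {x. n \<bullet> x < d}"

definition upper :: "point \<Rightarrow> real \<Rightarrow> point set" where
  "upper n d = {x. n \<bullet> x > d}"

(* wm, w, wp are the weights of the lower half-space, the plane and the upper half-space. *)

definition admissible_weights :: "real \<Rightarrow> real \<Rightarrow> real \<Rightarrow> bool" where
  "admissible_weights wm w wp \<longleftrightarrow>
     0 < wm \<and> 0 < wp \<and>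
     (wm \<noteq> wp \<longrightarrow> w = min wm wp) \<and>
     (wm = wp \<longrightarrow> 0 < w \<and> w \<le> wm)"

definition path_cost ::
  "real \<Rightarrow> real \<Rightarrow> real \<Rightarrow> point \<Rightarrow> point \<Rightarrow> point \<Rightarrow> point \<Rightarrow> real" where
  "path_cost wm w wp p a a1 x = wm * dist p a + w * dist a a1 + wp * dist a1 x"

(* The least element of the set of path costs; it exists by weighted_dist_is_min below. *)

definition weighted_dist ::
  "point set \<Rightarrow> real \<Rightarrow> real \<Rightarrow> real \<Rightarrow> point \<Rightarrow> point \<Rightarrow> real" where
  "weighted_dist F wm w wp p x =
     (LEAST r. \<exists>a\<in>F. \<exists>a1\<in>F. r = path_cost wm w wp p a a1 x)"

definition voronoi_cell ::
  "point set \<Rightarrow> real \<Rightarrow> real \<Rightarrow> real \<Rightarrow> point \<Rightarrow> point \<Rightarrow> point set \<Rightarrow> real \<Rightarrow> point set" where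
  "voronoi_cell F wm w wp v v' l C =
     {x \<in> l. weighted_dist F wm w wp v x + C < weighted_dist F wm w wp v' x}"

definition is_line :: "point set \<Rightarrow> bool" where
  "is_line l \<longleftrightarrow> affine l \<and> aff_dim l = 1"

(* affine_parallel relates translates of each other, so a line is parallel to a plane
   if it is a translate of some line in the plane. *)

definition line_parallel_to_plane :: "point set \<Rightarrow> point set \<Rightarrow> bool" where
  "line_parallel_to_plane l F \<longleftrightarrow> (\<exists>m. m \<subseteq> F \<and> affine_parallel l m)"

(* The library's is_interval on real^3 describes coordinate boxes, so an interval on a line
   is taken to be the image of a real interval under an affine parametrisation of the line.
   The empty set, points, segments, rays (with or without endpoints) and the whole line
   all qualify. *)

definition interval_on_line :: "point set \<Rightarrow> point set \<Rightarrow> bool" where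
  "interval_on_line l S \<longleftrightarrow>
     (\<exists>q u. u \<noteq> 0 \<and> l = range (\<lambda>t::real. q + t *\<^sub>R u) \<and>
        (\<exists>I::real set. is_interval I \<and> S = (\<lambda>t. q + t *\<^sub>R u) ` I))"

lemma path_cost_attains_min:
  assumes F: "closed F" "F \<noteq> {}" and pos: "0 < wm" "0 \<le> w" "0 < wp"
  shows "\<exists>a\<in>F. \<exists>a1\<in>F. \<forall>b\<in>F. \<forall>b1\<in>F.
           path_cost wm w wp p a a1 x \<le> path_cost wm w wp p b b1 x"
proof -
  obtain f where f: "f \<in> F" using F by blast
  define M where "M = path_cost wm w wp p f f x"
  define K where "K = (F \<inter> cball p (M / wm)) \<times> (F \<inter> cball x (M / wp))"
  have inK: "(b, b1) \<in> K" if "b \<in> F" "b1 \<in> F" "path_cost wm w wp p b b1 x \<le> M" for b b1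
  proof -
    have nn: "0 \<le> wm * dist p b" "0 \<le> w * dist b b1" "0 \<le> wp * dist b1 x"
      using pos by auto
    then have "wm * dist p b \<le> M" "wp * dist b1 x \<le> M"
      using that(3) unfolding path_cost_def by linarith+
    then show ?thesis
      using that pos by (simp add: K_def field_simps dist_commute)
  qed
  have "compact K"
    unfolding K_def using F by (intro compact_Times closed_Int_compact) auto
  moreover have "(f, f) \<in> K" using inK[of f f] f by (simp add: M_def)
  moreover have "continuous_on K (\<lambda>(a, a1). path_cost wm w wp p a a1 x)"
    unfolding path_cost_def case_prod_beta by (intro continuous_intros)
  ultimately obtain z where z: "z \<in> K"
    and zmin: "\<And>y. y \<in> K \<Longrightarrow> (case z of (a, a1) \<Rightarrow> path_cost wm w wp p a a1 x)
                   \<le> (case y of (a, a1) \<Rightarrow> path_cost wm w wp p a a1 x)"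
    using continuous_attains_inf[of K] by blast
  obtain a a1 where zz: "z = (a, a1)" by force
  have "path_cost wm w wp p a a1 x \<le> path_cost wm w wp p b b1 x"
    if "b \<in> F" "b1 \<in> F" for b b1
  proof (cases "path_cost wm w wp p b b1 x \<le> M")
    case True
    then show ?thesis using zmin[OF inK] that zz by auto
  next
    case False
    then show ?thesis using zmin[OF \<open>(f, f) \<in> K\<close>] zz by (simp add: M_def)
  qed
  moreover have "a \<in> F" "a1 \<in> F" using z zz by (auto simp: K_def)
  ultimately show ?thesis by blast
qed

lemma weighted_dist_is_min:
  assumes "n \<noteq> 0" "admissible_weights wm w wp"
  shows "\<exists>a\<in>plane n d. \<exists>a1\<in>plane n d.
           weighted_dist (plane n d) wm w wp p x = path_cost wm w wp p a a1 x"
    and "b \<in> plane n d \<Longrightarrow> b1 \<in> plane n d \<Longrightarrow>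
           weighted_dist (plane n d) wm w wp p x \<le> path_cost wm w wp p b b1 x"
proof -
  have "(d / (n \<bullet> n)) *\<^sub>R n \<in> plane n d" using assms(1) by (simp add: plane_def)
  then have ne: "plane n d \<noteq> {}" by blast
  have "closed (plane n d)" unfolding plane_def by (rule closed_hyperplane)
  moreover have "0 < wm" "0 \<le> w" "0 < wp"
    using assms(2) by (auto simp: admissible_weights_def)
  ultimately obtain a a1 where a: "a \<in> plane n d" "a1 \<in> plane n d"
    and le: "\<And>b b1. b \<in> plane n d \<Longrightarrow> b1 \<in> plane n d \<Longrightarrow>
      path_cost wm w wp p a a1 x \<le> path_cost wm w wp p b b1 x"
    using path_cost_attains_min[OF _ ne] by metis
  have eq: "weighted_dist (plane n d) wm w wp p x = path_cost wm w wp p a a1 x"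
    unfolding weighted_dist_def by (rule Least_equality) (use a le in blast)+
  show "\<exists>a\<in>plane n d. \<exists>a1\<in>plane n d.
           weighted_dist (plane n d) wm w wp p x = path_cost wm w wp p a a1 x"
    using eq a by blast
  show "weighted_dist (plane n d) wm w wp p x \<le> path_cost wm w wp p b b1 x"
    if "b \<in> plane n d" "b1 \<in> plane n d" using eq le that by simp
qed

end

theory Submission
  imports Defs
begin

text \<open>
  The weighted distance depends only on the two heights and on the horizontal distance, and it
  equals \<open>cost u\<close>, where \<open>u\<close> is the squared horizontal distance. By Snell's law the horizontal
  component of the (weighted) direction is constant along a shortest path; if it has length
  \<open>slope u * sqrt u\<close> and \<open>Z = (slope u)\<^sup>2 * u\<close> denotes its square, then
  \<open>1 / slope u = h / sqrt (wm\<^sup>2 - Z) + H / sqrt (wp\<^sup>2 - Z)\<close>, unless \<open>Z = w\<^sup>2\<close> and the path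
  runs along the plane for a while. Convex duality shows that along the line, at position \<open>s\<close>
  and with squared distance \<open>P\<close> between the projected line and the projected site, the cost
  has derivative \<open>slope (s\<^sup>2 + P) * s\<close>.

  The points \<open>(Z, (slope u)\<^sup>2)\<close> lie on a concave decreasing curve. Comparing two chords of this
  curve shows that the difference of the costs to the two sites has at most one critical point
  on the part of the line that is closer to the first site. If the cell were not an interval,
  the difference would have a local minimum there and, between it and the bisector of the two
  sites, also a local maximum. The case in which both sites project onto the projected line is
  settled by convexity, and the case in which their projections onto it coincide by monotonicity.
\<close>

section \<open>Convexity inequalities for square roots\<close>

lemma sqrt_le_tangent:
  fixes x y :: real
  assumes "0 < x" "0 \<le> y"
  shows "sqrt y \<le> sqrt x + (y - x) / (2 * sqrt x)"
proof -
  have "0 \<le> (sqrt y - sqrt x)\<^sup>2" by simp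
  then have "2 * sqrt x * sqrt y \<le> x + y"
    using assms by (simp add: power2_diff mult_ac add_ac)
  moreover have "sqrt x * sqrt x = x" using assms by simp
  moreover have "(sqrt y - sqrt x) * (2 * sqrt x) = 2 * sqrt x * sqrt y - 2 * (sqrt x * sqrt x)"
    by (simp only: algebra_simps)
  ultimately have "(sqrt y - sqrt x) * (2 * sqrt x) \<le> y - x" by linarith
  then have "sqrt y - sqrt x \<le> (y - x) / (2 * sqrt x)"
    using assms by (simp add: pos_le_divide_eq)
  then show ?thesis by simp
qed

text \<open>Jensen's inequality for the convex function \<open>1 / sqrt x\<close> at
  \<open>a^2\<close> and \<open>b^2\<close>, in squared form; the weighted mean of \<open>a\<close>
  and \<open>b\<close> serves as intermediate term.\<close>

lemma jensen_inverse_sqrt: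
  fixes a b s t :: real
  assumes "0 < a" "0 < b" "0 \<le> s" "0 \<le> t" "s + t = 1"
  shows "1 \<le> (s / a + t / b)\<^sup>2 * (s * a\<^sup>2 + t * b\<^sup>2)"
proof -
  have t: "t = 1 - s" using assms by simp
  have "s * a\<^sup>2 + t * b\<^sup>2 - (s * a + t * b)\<^sup>2 = s * t * (a - b)\<^sup>2"
    unfolding t by (simp add: power2_eq_square algebra_simps)
  then have le: "(s * a + t * b)\<^sup>2 \<le> s * a\<^sup>2 + t * b\<^sup>2"
    using assms by (smt (verit) mult_nonneg_nonneg zero_le_power2)
  have "(s / a + t / b) * (s * a + t * b) - 1 = s * t * (a - b)\<^sup>2 / (a * b)"
    using assms(1,2) unfolding t by (simp add: field_simps power2_eq_square)
  moreover have "0 \<le> s * t * (a - b)\<^sup>2 / (a * b)" using assms by simp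
  ultimately have "1 \<le> (s / a + t / b) * (s * a + t * b)" by linarith
  then have "1 \<le> ((s / a + t / b) * (s * a + t * b))\<^sup>2" by (simp add: one_le_power)
  also have "\<dots> \<le> (s / a + t / b)\<^sup>2 * (s * a\<^sup>2 + t * b\<^sup>2)"
    unfolding power_mult_distrib using le by (intro mult_left_mono) auto
  finally show ?thesis .
qed

section \<open>Snell's law and the existence of a stationary momentum\<close>

locale two_media =
  fixes h H wm w wp :: real
  assumes heights: "0 < h" "0 < H" and weights: "admissible_weights wm w wp"
begin

lemma weight_bounds: "0 < wm" "0 < wp" "0 < w" "w \<le> wm" "w \<le> wp"
  using weights unfolding admissible_weights_def by (cases "wm = wp"; force)+

text \<open>A ray with squared horizontal momentum \<open>Z\<close> is displaced horizontally by
  \<open>sqrt Z * drag Z\<close> while crossing both layers. Where the roots are positive,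
  \<open>drag\<close> is -2 times the derivative of \<open>vertical_cost\<close>.\<close>

definition drag :: "real \<Rightarrow> real" where
  "drag Z = h / sqrt (wm\<^sup>2 - Z) + H / sqrt (wp\<^sup>2 - Z)"

definition vertical_cost :: "real \<Rightarrow> real" where
  "vertical_cost Z = h * sqrt (wm\<^sup>2 - Z) + H * sqrt (wp\<^sup>2 - Z)"

text \<open>In \<open>stationary u k\<close>, \<open>k\<^sup>2 * u\<close> is the squared horizontal momentum; it equals \<open>w\<^sup>2\<close> only when
  \<open>w < wm = wp\<close>, where \<open>1 - k * drag (k\<^sup>2 * u)\<close> is the fraction of the horizontal
  displacement spent in the plane.\<close>

definition stationary :: "real \<Rightarrow> real \<Rightarrow> bool" where
  "stationary u k \<longleftrightarrow> 0 < k \<and> k\<^sup>2 * u \<le> w\<^sup>2 \<and> k\<^sup>2 * u < wm\<^sup>2 \<and> k\<^sup>2 * u < wp\<^sup>2 \<and>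
     k * drag (k\<^sup>2 * u) \<le> 1 \<and> (k * drag (k\<^sup>2 * u) = 1 \<or> k\<^sup>2 * u = w\<^sup>2)"

definition slope :: "real \<Rightarrow> real" where
  "slope u = (SOME k. stationary u k)"

text \<open>The dual objective \<open>sqrt (u * Z) + vertical_cost Z\<close> at
  \<open>Z = (slope u)^2 * u\<close>, where the root equals \<open>slope u * u\<close>.\<close>

definition cost :: "real \<Rightarrow> real" where
  "cost u = slope u * u + vertical_cost ((slope u)\<^sup>2 * u)"

lemma drag_pos: "Z < wm\<^sup>2 \<Longrightarrow> Z < wp\<^sup>2 \<Longrightarrow> 0 < drag Z"
  using heights by (simp add: drag_def add_pos_pos)

text \<open>The squared displacement \<open>z * (drag z)^2\<close> is continuous, vanishes at 0 and
  is at least \<open>u\<close> at \<open>Z\<close>, so the intermediate value theorem yields a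
  refracted ray with no segment in the plane.\<close>

lemma stationary_exists_below:
  assumes Z: "0 \<le> Z" "Z \<le> w\<^sup>2" "Z < wm\<^sup>2" "Z < wp\<^sup>2" and u: "0 \<le> u" "u \<le> Z * (drag Z)\<^sup>2"
  shows "\<exists>k. stationary u k"
proof -
  have "continuous_on {0..Z} (\<lambda>z. z * (drag z)\<^sup>2)"
    unfolding drag_def using Z by (intro continuous_intros) auto
  then obtain z where z: "0 \<le> z" "z \<le> Z" "z * (drag z)\<^sup>2 = u"
    using IVT'[of "\<lambda>z. z * (drag z)\<^sup>2" 0 u Z] Z u by auto
  have "0 < drag z" using drag_pos Z z by auto
  then have "stationary u (1 / drag z)"
    unfolding stationary_def using z Z by (auto simp: field_simps)
  then show ?thesis by blast
qed

text \<open>If \<open>w\<close> equals \<open>wm\<close> or \<open>wp\<close>, the layer of that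
  weight alone yields every displacement with \<open>Z < w^2\<close>. Otherwise \<open>w\<close> is
  below both, and a displacement too large for \<open>Z = w^2\<close> is completed along the
  plane.\<close>

lemma stationary_exists:
  assumes "0 \<le> u"
  shows "\<exists>k. stationary u k"
proof -
  have snell: "\<exists>k. stationary u k"
    if x: "0 < x" "w = y" and ge: "\<And>Z. Z < w\<^sup>2 \<Longrightarrow> x / sqrt (y\<^sup>2 - Z) \<le> drag Z" for x y
  proof -
    \<comment> \<open>The solution of \<open>Z * (x / sqrt (y^2 - Z))^2 = u\<close>, the
      displacement equation of a single layer of height \<open>x\<close> and weight
      \<open>y\<close>.\<close>
    define Z where "Z = u * y\<^sup>2 / (x\<^sup>2 + u)"
    have pos: "0 < x\<^sup>2 + u" using x assms by (simp add: add_pos_nonneg)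
    have "Z < w\<^sup>2" "0 \<le> Z"
      using pos x assms weight_bounds by (auto simp: Z_def field_simps)
    have "w\<^sup>2 \<le> wm\<^sup>2" "w\<^sup>2 \<le> wp\<^sup>2" using weight_bounds by (auto intro: power_mono)
    then have lt: "Z < wm\<^sup>2" "Z < wp\<^sup>2" using \<open>Z < w\<^sup>2\<close> by auto
    have eq: "y\<^sup>2 - Z = x\<^sup>2 * y\<^sup>2 / (x\<^sup>2 + u)"
      using pos by (simp add: Z_def field_simps)
    have "0 < y\<^sup>2 - Z" using \<open>Z < w\<^sup>2\<close> x by simp
    then have "(x / sqrt (y\<^sup>2 - Z))\<^sup>2 = x\<^sup>2 / (y\<^sup>2 - Z)" by (simp add: power_divide)
    also have "Z * \<dots> = u"
      proof -
      have "x \<noteq> 0" "y \<noteq> 0" "x\<^sup>2 + u \<noteq> 0" using pos x weight_bounds by auto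
      then show ?thesis unfolding eq by (simp add: Z_def)
    qed
    finally have "u = Z * (x / sqrt (y\<^sup>2 - Z))\<^sup>2" by simp
    also have "\<dots> \<le> Z * (drag Z)\<^sup>2"
      using ge[OF \<open>Z < w\<^sup>2\<close>] \<open>0 \<le> Z\<close> \<open>0 < y\<^sup>2 - Z\<close> x
      by (intro mult_left_mono power_mono) auto
    finally show ?thesis
      using stationary_exists_below \<open>0 \<le> Z\<close> \<open>Z < w\<^sup>2\<close> lt assms by simp
  qed
  have sq: "w\<^sup>2 \<le> wm\<^sup>2" "w\<^sup>2 \<le> wp\<^sup>2" using weight_bounds by (auto intro: power_mono)
  consider "w = wm" | "w = wp" | "w < wm" "w < wp" using weight_bounds by linarith
  then show ?thesis
  proof cases
    case 1
    show ?thesis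
      by (rule snell[OF heights(1) 1]) (use heights sq in \<open>auto simp: drag_def\<close>)
  next
    case 2
    show ?thesis
      by (rule snell[OF heights(2) 2]) (use heights sq in \<open>auto simp: drag_def\<close>)
  next
    case 3
    then have lt: "w\<^sup>2 < wm\<^sup>2" "w\<^sup>2 < wp\<^sup>2"
      using weight_bounds by (auto intro: power_strict_mono)
    show ?thesis
    proof (cases "u \<le> w\<^sup>2 * (drag (w\<^sup>2))\<^sup>2")
      case True
      then show ?thesis by (intro stationary_exists_below[of "w\<^sup>2"]) (use lt assms in auto)
    next
      case False
      have "0 < u" using False assms
        by (smt (verit) zero_le_mult_iff zero_le_power2)
      define k where "k = w / sqrt u"
      have k: "0 < k" "k\<^sup>2 * u = w\<^sup>2"
        using \<open>0 < u\<close> weight_bounds by (auto simp: k_def power_divide)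
      have "(w * drag (w\<^sup>2))\<^sup>2 < (sqrt u)\<^sup>2"
        using False \<open>0 < u\<close> by (simp add: power_mult_distrib)
      then have "w * drag (w\<^sup>2) < sqrt u" by (rule power_less_imp_less_base) (use \<open>0 < u\<close> in simp)
      then have "k * drag (w\<^sup>2) \<le> 1" using \<open>0 < u\<close> by (simp add: k_def field_simps)
      then have "stationary u k" unfolding stationary_def k(2) using k lt by simp
      then show ?thesis by blast
    qed
  qed
qed

lemma stationary_slope: "0 \<le> u \<Longrightarrow> stationary u (slope u)"
  unfolding slope_def by (rule someI_ex[OF stationary_exists])

lemma slope_pos: "0 \<le> u \<Longrightarrow> 0 < slope u"
  using stationary_slope by (simp add: stationary_def)

section \<open>Convex duality and the derivative of the cost\<close>

text \<open>\<open>vertical_cost\<close> is concave with derivative \<open>- drag Y / 2\<close> at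
  \<open>Y = (slope u)^2 * u\<close>. Stationarity makes this \<open>- 1 / (2 * slope u)\<close>,
  unless \<open>Y\<close> is the right end \<open>w^2\<close>, where only \<open>Z \<le> Y\<close>
  occurs and \<open>drag Y \<le> 1 / slope u\<close> suffices.\<close>

lemma vertical_cost_le:
  assumes "0 \<le> u" "Z \<le> w\<^sup>2"
  shows "vertical_cost Z \<le> vertical_cost ((slope u)\<^sup>2 * u) - (Z - (slope u)\<^sup>2 * u) / (2 * slope u)"
proof -
  define k Y where "k = slope u" and "Y = k\<^sup>2 * u"
  have st: "stationary u k" using assms stationary_slope by (simp add: k_def)
  then have Y: "0 < k" "Y < wm\<^sup>2" "Y < wp\<^sup>2" "Y \<le> w\<^sup>2" "k * drag Y \<le> 1"
    "k * drag Y = 1 \<or> Y = w\<^sup>2" by (auto simp: stationary_def Y_def)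
  have sq: "w\<^sup>2 \<le> wm\<^sup>2" "w\<^sup>2 \<le> wp\<^sup>2" using weight_bounds by (auto intro: power_mono)
  have "h * sqrt (wm\<^sup>2 - Z) \<le> h * (sqrt (wm\<^sup>2 - Y) + ((wm\<^sup>2 - Z) - (wm\<^sup>2 - Y)) / (2 * sqrt (wm\<^sup>2 - Y)))"
    using Y sq assms heights by (intro mult_left_mono sqrt_le_tangent) auto
  moreover
  have "H * sqrt (wp\<^sup>2 - Z) \<le> H * (sqrt (wp\<^sup>2 - Y) + ((wp\<^sup>2 - Z) - (wp\<^sup>2 - Y)) / (2 * sqrt (wp\<^sup>2 - Y)))"
    using Y sq assms heights by (intro mult_left_mono sqrt_le_tangent) auto
  ultimately have "vertical_cost Z \<le> vertical_cost Y - drag Y * (Z - Y) / 2"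
    unfolding vertical_cost_def drag_def by (simp add: algebra_simps diff_divide_distrib add_divide_distrib)
  moreover have "(Z - Y) / (2 * k) \<le> drag Y * (Z - Y) / 2"
  proof (cases "k * drag Y = 1")
    case True
    then have "drag Y = 1 / k" using Y by (simp add: field_simps)
    then show ?thesis by simp
  next
    case False
    then have "Z - Y \<le> 0" using Y assms by auto
    moreover have "drag Y \<le> 1 / k" using Y by (simp add: field_simps)
    ultimately have "1 / k * (Z - Y) \<le> drag Y * (Z - Y)" by (rule mult_right_mono_neg[rotated])
    then have "1 / k * (Z - Y) / 2 \<le> drag Y * (Z - Y) / 2" by (rule divide_right_mono) simp
    then show ?thesis by (simp add: mult.commute)
  qed
  ultimately show ?thesis unfolding k_def Y_def by linarith
qed

text \<open>\<open>cost\<close> is concave in the squared distance: the tangent bound on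
  \<open>vertical_cost\<close> at the momentum of \<open>u'\<close> leaves only
  \<open>0 \<le> u' * (k - k')^2\<close>.\<close>

lemma cost_le_tangent:
  assumes "0 \<le> u" "0 \<le> u'"
  shows "cost u' \<le> cost u + slope u / 2 * (u' - u)"
proof -
  define k k' where "k = slope u" and "k' = slope u'"
  have k: "0 < k" "k'\<^sup>2 * u' \<le> w\<^sup>2"
    using assms stationary_slope by (auto simp: k_def k'_def stationary_def)
  have "0 \<le> u' * (k - k')\<^sup>2" using assms by simp
  then have "k' * u' - (k'\<^sup>2 * u' - k\<^sup>2 * u) / (2 * k) \<le> k * u + k / 2 * (u' - u)"
    using k(1) by (simp add: field_simps power2_eq_square)
  then show ?thesis
    using vertical_cost_le[OF assms(1), of "k'\<^sup>2 * u'"] k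
    unfolding cost_def k_def[symmetric] k'_def[symmetric] by linarith
qed

text \<open>Weak duality: every admissible momentum gives a lower bound on the cost.\<close>

lemma dual_le_cost:
  assumes "0 \<le> u" "0 \<le> Z" "Z \<le> w\<^sup>2"
  shows "sqrt (u * Z) + vertical_cost Z \<le> cost u"
proof -
  define k where "k = slope u"
  have k: "0 < k" using slope_pos assms by (simp add: k_def)
  have "0 \<le> (sqrt Z - k * sqrt u)\<^sup>2" by simp
  then have "2 * k * sqrt (u * Z) \<le> Z + k\<^sup>2 * u"
    using assms by (simp add: power2_diff power_mult_distrib real_sqrt_mult mult_ac)
  then have "sqrt (u * Z) \<le> k * u + (Z - k\<^sup>2 * u) / (2 * k)"
    using k by (simp add: field_simps power2_eq_square)
  then show ?thesis
    using vertical_cost_le[OF assms(1,3)] unfolding cost_def k_def[symmetric] by linarith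
qed

text \<open>Convexity along a line: the momentum that is optimal at \<open>s\<close> remains
  admissible in the dual problem at \<open>t\<close>.\<close>

lemma cost_ge_tangent:
  assumes "0 \<le> P"
  shows "cost (s\<^sup>2 + P) + slope (s\<^sup>2 + P) * s * (t - s) \<le> cost (t\<^sup>2 + P)"
proof -
  define u k where "u = s\<^sup>2 + P" and "k = slope u"
  have u: "0 \<le> u" using assms by (simp add: u_def)
  have st: "0 < k" "k\<^sup>2 * u \<le> w\<^sup>2"
    using stationary_slope[OF u] by (auto simp: k_def stationary_def)
  \<comment> \<open>Cauchy-Schwarz for the vectors \<open>(s, sqrt P)\<close> and
    \<open>(t, sqrt P)\<close>.\<close>
  have "(s * t + P)\<^sup>2 \<le> u * (t\<^sup>2 + P)"
  proof -
    have "u * (t\<^sup>2 + P) - (s * t + P)\<^sup>2 = P * (s - t)\<^sup>2"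
      by (simp add: u_def power2_eq_square algebra_simps)
    then show ?thesis using assms by (smt (verit) mult_nonneg_nonneg zero_le_power2)
  qed
  then have "k\<^sup>2 * (s * t + P)\<^sup>2 \<le> k\<^sup>2 * (u * (t\<^sup>2 + P))" by (intro mult_left_mono) auto
  then have "(k * (s * t + P))\<^sup>2 \<le> (t\<^sup>2 + P) * (k\<^sup>2 * u)"
    by (simp add: power_mult_distrib mult_ac)
  then have "k * (s * t + P) \<le> sqrt ((t\<^sup>2 + P) * (k\<^sup>2 * u))" by (rule real_le_rsqrt)
  moreover have "sqrt ((t\<^sup>2 + P) * (k\<^sup>2 * u)) + vertical_cost (k\<^sup>2 * u) \<le> cost (t\<^sup>2 + P)"
    using assms u st by (intro dual_le_cost) auto
  moreover have "k * (s * t + P) = k * u + k * s * (t - s)"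
    by (simp add: u_def power2_eq_square algebra_simps)
  ultimately show ?thesis unfolding cost_def u_def[symmetric] k_def[symmetric] by linarith
qed

text \<open>Convexity in \<open>s\<close> bounds the increment below by a linear function, and
  concavity in \<open>s^2 + P\<close> bounds it above up to a quadratic error; so the difference
  quotient converges.\<close>

lemma cost_has_derivative:
  assumes "0 \<le> P"
  shows "((\<lambda>s. cost (s\<^sup>2 + P)) has_real_derivative slope (s\<^sup>2 + P) * s) (at s)"
proof -
  define k where "k = slope (s\<^sup>2 + P)"
  have k: "0 < k" using slope_pos assms by (simp add: k_def)
  have bound: "\<bar>(cost ((s + e)\<^sup>2 + P) - cost (s\<^sup>2 + P)) / e - k * s\<bar> \<le> k / 2 * \<bar>e\<bar>"
    if "e \<noteq> 0" for e
  proof -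
    define X where "X = cost ((s + e)\<^sup>2 + P) - cost (s\<^sup>2 + P) - k * s * e"
    have "0 \<le> X"
      using cost_ge_tangent[OF assms, of s "s + e"] by (simp add: X_def k_def)
    moreover have "X \<le> k / 2 * e\<^sup>2"
    proof -
      have nonneg: "0 \<le> s\<^sup>2 + P" "0 \<le> (s + e)\<^sup>2 + P" using assms by auto
      have "k / 2 * ((s + e)\<^sup>2 + P - (s\<^sup>2 + P)) = k * s * e + k / 2 * e\<^sup>2"
        by (simp add: power2_eq_square field_simps)
      then show ?thesis
        using cost_le_tangent[of "s\<^sup>2 + P" "(s + e)\<^sup>2 + P", folded k_def, OF nonneg]
        unfolding X_def by linarith
    qed
    ultimately have "\<bar>X\<bar> \<le> k / 2 * \<bar>e\<bar> * \<bar>e\<bar>" by (simp add: power2_eq_square mult.assoc)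
    then have "\<bar>X / e\<bar> \<le> k / 2 * \<bar>e\<bar>" using that by (simp add: field_simps abs_divide)
    moreover have "X / e = (cost ((s + e)\<^sup>2 + P) - cost (s\<^sup>2 + P)) / e - k * s"
      using that by (simp add: X_def field_simps)
    ultimately show ?thesis by simp
  qed
  have "((\<lambda>e. k / 2 * \<bar>e\<bar>) \<longlongrightarrow> k / 2 * \<bar>0\<bar>) (at 0)" by (intro tendsto_intros)
  then have lim: "((\<lambda>e. k / 2 * \<bar>e\<bar>) \<longlongrightarrow> 0) (at 0)" by simp
  have "\<forall>\<^sub>F e in at 0. norm ((cost ((s + e)\<^sup>2 + P) - cost (s\<^sup>2 + P)) / e - k * s) \<le> k / 2 * \<bar>e\<bar>"
    unfolding eventually_at_filter real_norm_def using bound by (intro always_eventually) blast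
  then have "((\<lambda>e. (cost ((s + e)\<^sup>2 + P) - cost (s\<^sup>2 + P)) / e - k * s) \<longlongrightarrow> 0) (at 0)"
    using lim by (rule Lim_null_comparison)
  then show ?thesis unfolding DERIV_def k_def[symmetric] by (rule LIM_zero_cancel)
qed

section \<open>Monotonicity, and concavity of the curve of levels and squared slopes\<close>

lemma slope_antimono:
  assumes "0 \<le> u" "u \<le> u'"
  shows "slope u' \<le> slope u"
proof (cases "u = u'")
  case False
  have "0 \<le> (slope u - slope u') / 2 * (u' - u)"
    using cost_le_tangent[of u u'] cost_le_tangent[of u' u] assms by (simp add: algebra_simps diff_divide_distrib)
  then show ?thesis using assms False by (simp add: zero_le_mult_iff)
qed simp

text \<open>The derivative of the function \<open>cost (s^2)\<close>, convex in \<open>s\<close>, is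
  monotone.\<close>

lemma momentum_mono:
  assumes "0 \<le> u" "u \<le> u'"
  shows "slope u * sqrt u \<le> slope u' * sqrt u'"
proof (cases "u = u'")
  case False
  have "0 \<le> (slope u' * sqrt u' - slope u * sqrt u) * (sqrt u' - sqrt u)"
    using cost_ge_tangent[of 0 "sqrt u" "sqrt u'"] cost_ge_tangent[of 0 "sqrt u'" "sqrt u"] assms
    by (simp add: algebra_simps)
  moreover have "sqrt u < sqrt u'" using False assms by simp
  ultimately show ?thesis by (simp add: zero_le_mult_iff)
qed simp

lemma cost_mono:
  assumes "0 \<le> u" "u \<le> u'"
  shows "cost u \<le> cost u'"
proof -
  have "0 \<le> slope u * sqrt u * (sqrt u' - sqrt u)"
    using assms slope_pos[of u] by (intro mult_nonneg_nonneg) auto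
  then show ?thesis using cost_ge_tangent[of 0 "sqrt u" "sqrt u'"] assms by simp
qed

definition level :: "real \<Rightarrow> real" where
  "level u = (slope u)\<^sup>2 * u"

lemma level_mono:
  assumes "0 \<le> u" "u \<le> u'"
  shows "level u \<le> level u'"
proof -
  have "(slope u * sqrt u)\<^sup>2 \<le> (slope u' * sqrt u')\<^sup>2"
    using momentum_mono[OF assms] assms slope_pos[of u] by (intro power_mono) auto
  then show ?thesis using assms by (simp add: level_def power_mult_distrib)
qed

text \<open>Concavity of the curve \<open>(level, slope^2)\<close>, cross-multiplied so that
  coinciding levels are covered. If the path of \<open>v\<close> may use the plane,
  \<open>level v\<close> is already maximal; otherwise the supporting line at \<open>v\<close> lies
  above the other two points.\<close>

lemma slope_sq_three_points:
  assumes "0 \<le> u" "u \<le> v" "v \<le> z"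
  shows "((slope u)\<^sup>2 - (slope v)\<^sup>2) * (level z - level v)
       \<le> ((slope v)\<^sup>2 - (slope z)\<^sup>2) * (level v - level u)"
proof -
  have st: "stationary x (slope x)" if "x \<in> {u,v,z}" for x
    using that assms stationary_slope by auto
  have lv: "level u \<le> level v" "level v \<le> level z" using level_mono assms by auto
  show ?thesis
  proof (cases "slope v * drag (level v) = 1")
    case False
    then have "level v = w\<^sup>2" using st[of v] by (auto simp: stationary_def level_def)
    then have "level z = level v" using st[of z] lv by (auto simp: stationary_def level_def)
    moreover have "(slope z)\<^sup>2 \<le> (slope v)\<^sup>2"
      using slope_antimono[of v z] slope_pos[of z] assms by (intro power_mono) auto
    ultimately show ?thesis using lv by simp
  next
    case True
    define k X Y where "k = slope v" and "X = wm\<^sup>2 - level v" and "Y = wp\<^sup>2 - level v"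
    have k: "0 < k" "0 < X" "0 < Y"
      using st[of v] by (auto simp: stationary_def level_def k_def X_def Y_def)
    \<comment> \<open>The fractions of the horizontal displacement made in the two layers; they sum
      to 1 and serve as Jensen weights.\<close>
    define p q where "p = k * h / sqrt X" and "q = k * H / sqrt Y"
    have pq: "0 \<le> p" "0 \<le> q" using k heights by (auto simp: p_def q_def)
    have "p + q = 1"
      using True by (simp add: drag_def p_def q_def k_def X_def Y_def algebra_simps)
    define c where "c = k\<^sup>2 * (p / X + q / Y)"
    \<comment> \<open>Supporting line of the curve \<open>Z \<mapsto> (drag Z)\<^sup>-\<^sup>2\<close> at \<open>level v\<close>.\<close>
    have tangent: "(slope x)\<^sup>2 \<le> k\<^sup>2 - c * (level x - level v)" if x: "x \<in> {u,v,z}" for x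
    proof -
      define j X' Y' where "j = slope x" and "X' = wm\<^sup>2 - level x" and "Y' = wp\<^sup>2 - level x"
      have j: "0 < j" "0 < X'" "0 < Y'" "j * (h / sqrt X' + H / sqrt Y') \<le> 1"
        using st[OF x] by (auto simp: stationary_def level_def j_def X'_def Y'_def drag_def)
      \<comment> \<open>With these ratios \<open>p / a + q / b\<close> is
        \<open>k * drag (level x)\<close>, while \<open>p * a^2 + q * b^2\<close> is affine in
        \<open>level x\<close>.\<close>
      define a b where "a = sqrt X' / sqrt X" and "b = sqrt Y' / sqrt Y"
      have ab: "0 < a" "0 < b" using j k by (auto simp: a_def b_def)
      have "p / a = k * (h / sqrt X')" "q / b = k * (H / sqrt Y')"
        using j k by (auto simp: p_def q_def a_def b_def)
      then have sum: "p / a + q / b = k * (h / sqrt X' + H / sqrt Y')" by (simp add: algebra_simps)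
      have "j * (p / a + q / b) \<le> k"
        using mult_left_mono[OF j(4), of k] k unfolding sum by (simp add: algebra_simps)
      moreover have "0 \<le> j * (p / a + q / b)" using j pq ab by simp
      ultimately have "(j * (p / a + q / b))\<^sup>2 \<le> k\<^sup>2" by (intro power_mono)
      then have "(j * (p / a + q / b))\<^sup>2 * (p * a\<^sup>2 + q * b\<^sup>2) \<le> k\<^sup>2 * (p * a\<^sup>2 + q * b\<^sup>2)"
        using pq by (intro mult_right_mono) auto
      moreover have "j\<^sup>2 * 1 \<le> j\<^sup>2 * ((p / a + q / b)\<^sup>2 * (p * a\<^sup>2 + q * b\<^sup>2))"
        using jensen_inverse_sqrt[OF ab pq \<open>p + q = 1\<close>] by (intro mult_left_mono) auto
      ultimately have "j\<^sup>2 \<le> k\<^sup>2 * (p * a\<^sup>2 + q * b\<^sup>2)" by (simp add: power_mult_distrib mult_ac)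
      also have "p * a\<^sup>2 + q * b\<^sup>2 = p * (X' / X) + q * (Y' / Y)"
        using j k by (simp add: a_def b_def power_divide)
      also have "\<dots> = (p + q) - (p / X + q / Y) * (level x - level v)"
      proof -
        have "X' / X = 1 - (level x - level v) / X" "Y' / Y = 1 - (level x - level v) / Y"
          using k by (auto simp: X'_def Y'_def X_def Y_def field_simps)
        then have "p * (X' / X) + q * (Y' / Y) =
            p * (1 - (level x - level v) / X) + q * (1 - (level x - level v) / Y)" by simp
        also have "\<dots> = (p + q) - (p / X + q / Y) * (level x - level v)"
          using k by (simp add: field_simps)
        finally show ?thesis .
      qed
      finally show ?thesis
        using \<open>p + q = 1\<close> by (simp add: j_def c_def algebra_simps)
    qed
    have "((slope u)\<^sup>2 - (slope v)\<^sup>2) * (level z - level v)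
        \<le> (c * (level v - level u)) * (level z - level v)"
      using tangent[of u] lv by (intro mult_right_mono) (auto simp: k_def algebra_simps)
    also have "\<dots> = (c * (level z - level v)) * (level v - level u)" by simp
    also have "\<dots> \<le> ((slope v)\<^sup>2 - (slope z)\<^sup>2) * (level v - level u)"
      using tangent[of z] lv by (intro mult_right_mono) (auto simp: k_def algebra_simps)
    finally show ?thesis .
  qed
qed

text \<open>Each chord is compared with the long chord from \<open>u\<close> to \<open>v'\<close>,
  whose extent \<open>L\<close> in the level is then cancelled.\<close>

lemma slope_sq_chords:
  assumes "0 \<le> u" "u \<le> v" "u \<le> u'" "u' \<le> v'" "v \<le> v'"
  shows "((slope u)\<^sup>2 - (slope v)\<^sup>2) * (level v' - level u')
       \<le> ((slope u')\<^sup>2 - (slope v')\<^sup>2) * (level v - level u)"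
proof -
  have lv: "level u \<le> level v" "level u \<le> level u'" "level u' \<le> level v'" "level v \<le> level v'"
    using assms by (auto intro: level_mono)
  define L where "L = level v' - level u"
  have "((slope u)\<^sup>2 - (slope v)\<^sup>2) * L \<le> ((slope u)\<^sup>2 - (slope v')\<^sup>2) * (level v - level u)"
    using slope_sq_three_points[of u v v'] assms by (simp add: L_def algebra_simps)
  then have "((slope u)\<^sup>2 - (slope v)\<^sup>2) * L * (level v' - level u')
      \<le> ((slope u)\<^sup>2 - (slope v')\<^sup>2) * (level v - level u) * (level v' - level u')"
    using lv by (intro mult_right_mono) auto
  moreover have "((slope u)\<^sup>2 - (slope v')\<^sup>2) * (level v' - level u')
      \<le> ((slope u')\<^sup>2 - (slope v')\<^sup>2) * L"
    using slope_sq_three_points[of u u' v'] assms by (simp add: L_def algebra_simps)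
  then have "((slope u)\<^sup>2 - (slope v')\<^sup>2) * (level v' - level u') * (level v - level u)
      \<le> ((slope u')\<^sup>2 - (slope v')\<^sup>2) * L * (level v - level u)"
    using lv by (intro mult_right_mono) auto
  ultimately have *: "L * (((slope u)\<^sup>2 - (slope v)\<^sup>2) * (level v' - level u'))
      \<le> L * (((slope u')\<^sup>2 - (slope v')\<^sup>2) * (level v - level u))"
    by (simp add: mult_ac)
  show ?thesis
  proof (cases "L = 0")
    case True
    then have "level v' = level u'" "level v = level u" using lv by (auto simp: L_def)
    then show ?thesis by simp
  next
    case False
    then have "0 < L" using lv by (simp add: L_def)
    then show ?thesis using * by simp
  qed
qed

section \<open>The difference of the costs to two sites along a line\<close>

lemma cost_gap_has_derivative:
  assumes "0 \<le> P" "0 \<le> Q"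
  shows "((\<lambda>s. cost ((s + b)\<^sup>2 + Q) - cost (s\<^sup>2 + P)) has_real_derivative
          slope ((s + b)\<^sup>2 + Q) * (s + b) - slope (s\<^sup>2 + P) * s) (at s)"
proof -
  have "((\<lambda>s. cost ((s + b)\<^sup>2 + Q)) has_real_derivative slope ((s + b)\<^sup>2 + Q) * (s + b)) (at s)"
    using cost_has_derivative[OF assms(2), of "s + b"] by (simp add: DERIV_shift)
  then show ?thesis using cost_has_derivative[OF assms(1)] by (intro DERIV_diff)
qed

text \<open>At a critical point both momenta have the same component along the line. The chord
  comparison then gives \<open>k2' / k1' \<le> k2 / k1\<close>, but these ratios are
  \<open>s' / (s' + b)\<close> and \<open>s / (s + b)\<close>, and \<open>s / (s + b)\<close> is
  strictly increasing.\<close>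

lemma cost_gap_critical_point_unique:
  assumes PQ: "0 \<le> P" "0 \<le> Q" "\<not> (P = 0 \<and> Q = 0)" and "0 < b" "s < s'"
    and le: "s\<^sup>2 + P \<le> (s + b)\<^sup>2 + Q" "s'\<^sup>2 + P \<le> (s' + b)\<^sup>2 + Q"
    and crit: "slope (s\<^sup>2 + P) * s = slope ((s + b)\<^sup>2 + Q) * (s + b)"
              "slope (s'\<^sup>2 + P) * s' = slope ((s' + b)\<^sup>2 + Q) * (s' + b)"
  shows False
proof -
  define k1 k2 k1' k2' where k: "k1 = slope (s\<^sup>2 + P)" "k2 = slope ((s + b)\<^sup>2 + Q)"
    "k1' = slope (s'\<^sup>2 + P)" "k2' = slope ((s' + b)\<^sup>2 + Q)"
  have pos: "0 < k1" "0 < k2" "0 < k1'" "0 < k2'"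
    unfolding k using PQ by (auto intro!: slope_pos)
  have "k2 \<le> k1" unfolding k using PQ le by (intro slope_antimono) auto
  have c: "k1 * s = k2 * (s + b)" "k1' * s' = k2' * (s' + b)" using crit by (auto simp: k)
  have "0 < s"
  proof (rule ccontr)
    assume "\<not> 0 < s"
    then have "k1 * s \<le> k2 * s" using \<open>k2 \<le> k1\<close> by (intro mult_right_mono_neg) auto
    moreover have "0 < k2 * b" using pos \<open>0 < b\<close> by simp
    ultimately show False using c by (simp add: distrib_left)
  qed
  have "k2 < k1"
  proof (rule ccontr)
    assume "\<not> k2 < k1"
    then have "k1 * s \<le> k2 * s" using \<open>0 < s\<close> by simp
    moreover have "0 < k2 * b" using pos \<open>0 < b\<close> by simp
    ultimately show False using c by (simp add: distrib_left)
  qed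
  define M M' where "M = (k1 * s)\<^sup>2" and "M' = (k1' * s')\<^sup>2"
  have lv: "level (s\<^sup>2 + P) = M + P * k1\<^sup>2" "level (s'\<^sup>2 + P) = M' + P * k1'\<^sup>2"
    by (simp_all add: level_def M_def M'_def k power_mult_distrib algebra_simps)
  have lv': "level ((s + b)\<^sup>2 + Q) = M + Q * k2\<^sup>2" "level ((s' + b)\<^sup>2 + Q) = M' + Q * k2'\<^sup>2"
    unfolding M_def M'_def c power_mult_distrib
    unfolding level_def k by (simp_all only: distrib_left mult.commute[of Q])
  \<comment> \<open>Monotonicity of \<open>level\<close> gives
    \<open>P * k1^2 \<le> Q * k2^2\<close>. With \<open>Q \<le> P\<close> and \<open>k2 < k1\<close>
    this forces \<open>P = Q = 0\<close>.\<close>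
  have "P < Q"
  proof (rule ccontr)
    assume "\<not> P < Q"
    have "P * k1\<^sup>2 \<le> Q * k2\<^sup>2" using level_mono[OF _ le(1)] PQ lv lv' by simp
    also have "\<dots> \<le> P * k2\<^sup>2" using \<open>\<not> P < Q\<close> by (intro mult_right_mono) auto
    finally have "P * (k1\<^sup>2 - k2\<^sup>2) \<le> 0" by (simp add: algebra_simps)
    moreover have "k2\<^sup>2 < k1\<^sup>2" using \<open>k2 < k1\<close> pos by (intro power_strict_mono) auto
    ultimately have "P = 0" using PQ by (simp add: mult_le_0_iff)
    then show False using PQ \<open>\<not> P < Q\<close> by simp
  qed
  have sq: "s\<^sup>2 \<le> s'\<^sup>2" "(s + b)\<^sup>2 \<le> (s' + b)\<^sup>2"
    using \<open>0 < s\<close> \<open>s < s'\<close> \<open>0 < b\<close> by (auto intro: power_mono)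
  have "(k1\<^sup>2 - k2\<^sup>2) * ((M' + Q * k2'\<^sup>2) - (M' + P * k1'\<^sup>2))
      \<le> (k1'\<^sup>2 - k2'\<^sup>2) * ((M + Q * k2\<^sup>2) - (M + P * k1\<^sup>2))"
    using slope_sq_chords[of "s\<^sup>2 + P" "(s + b)\<^sup>2 + Q" "s'\<^sup>2 + P" "(s' + b)\<^sup>2 + Q"] PQ sq le
    unfolding lv lv' by (simp add: k)
  \<comment> \<open>The terms in \<open>M\<close> and \<open>M'\<close> cancel, since both slopes have the same momentum along the line.\<close>
  then have "0 \<le> (Q - P) * ((k1' * k2)\<^sup>2 - (k1 * k2')\<^sup>2)"
    by (simp add: power_mult_distrib algebra_simps)
  then have "(k1 * k2')\<^sup>2 \<le> (k1' * k2)\<^sup>2" using \<open>P < Q\<close> by (simp add: zero_le_mult_iff)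
  then have "k1 * k2' \<le> k1' * k2" by (rule power2_le_imp_le) (use pos in simp)
  then have "(k1 * k2') * (s * s') \<le> (k1' * k2) * (s * s')"
    using \<open>0 < s\<close> \<open>s < s'\<close> by (intro mult_right_mono) auto
  then have "(k1 * s) * (k2' * s') \<le> (k1' * s') * (k2 * s)" by (simp add: mult_ac)
  then have "(k2 * k2') * ((s + b) * s') \<le> (k2 * k2') * ((s' + b) * s)"
    unfolding c by (simp add: mult_ac)
  then have "(s + b) * s' \<le> (s' + b) * s" using pos by simp
  then show False using \<open>s < s'\<close> \<open>0 < b\<close> by (simp add: algebra_simps)
qed

lemma cost_gap_between_shifted:
  assumes PQ: "0 \<le> P" "0 \<le> Q" and b: "0 < b" and "0 \<le> C" and s: "s1 < s2" "s2 < s3"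
    and gap: "cost (s1\<^sup>2 + P) + C < cost ((s1 + b)\<^sup>2 + Q)" "cost (s3\<^sup>2 + P) + C < cost ((s3 + b)\<^sup>2 + Q)"
  shows "cost (s2\<^sup>2 + P) + C < cost ((s2 + b)\<^sup>2 + Q)"
proof (rule ccontr)
  define D where "D = (\<lambda>s. cost ((s + b)\<^sup>2 + Q) - cost (s\<^sup>2 + P))"
  define D' where "D' = (\<lambda>s. slope ((s + b)\<^sup>2 + Q) * (s + b) - slope (s\<^sup>2 + P) * s)"
  have deriv: "(D has_real_derivative D' s) (at s)" for s
    unfolding D_def D'_def by (rule cost_gap_has_derivative[OF PQ])
  then have cont: "continuous_on X D" for X
    by (meson DERIV_isCont continuous_at_imp_continuous_on)
  assume "\<not> ?thesis"
  then have D: "D s2 \<le> C" "C < D s1" "C < D s3" using gap by (auto simp: D_def)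
  \<comment> \<open>The point of the line equidistant from both sites; the gap \<open>D\<close>
    vanishes there and is positive only to its right.\<close>
  define s0 where "s0 = (P - Q - b\<^sup>2) / (2 * b)"
  have radii: "(s + b)\<^sup>2 + Q - (s\<^sup>2 + P) = 2 * b * (s - s0)" for s
    using b by (simp add: s0_def field_simps power2_eq_square)
  have s0: "s0 < s" if "0 < D s" for s
  proof (rule ccontr)
    assume "\<not> s0 < s"
    then have "2 * b * (s - s0) \<le> 0" using b by (simp add: mult_le_0_iff)
    then have "(s + b)\<^sup>2 + Q \<le> s\<^sup>2 + P" using radii[of s] by linarith
    then have "D s \<le> 0" using cost_mono[of "(s + b)\<^sup>2 + Q" "s\<^sup>2 + P"] PQ by (simp add: D_def)
    then show False using that by simp
  qed
  have le: "s\<^sup>2 + P \<le> (s + b)\<^sup>2 + Q" if "s0 \<le> s" for s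
  proof -
    have "0 \<le> 2 * b * (s - s0)" using b that by simp
    then show ?thesis using radii[of s] by linarith
  qed
  have "s0 < s1" using s0 D \<open>0 \<le> C\<close> by simp
  have "D s0 = 0" using radii[of s0] by (simp add: D_def)
  obtain y where y: "y \<in> {s1..s3}" "\<And>t. t \<in> {s1..s3} \<Longrightarrow> D y \<le> D t"
    using continuous_attains_inf[of "{s1..s3}" D] cont s by auto
  have "D y \<le> C" using y(2)[of s2] s D by simp
  then have "y \<noteq> s1" "y \<noteq> s3" using D by auto
  then have ys: "s1 < y" "y < s3" using y by auto
  have y0: "D' y = 0"
    by (rule DERIV_local_min[OF deriv, of "min (y - s1) (s3 - y)"])
       (use ys y(2) in \<open>auto simp: abs_if split: if_splits\<close>)
  \<comment> \<open>The maximum is interior: \<open>D s1\<close> exceeds \<open>C\<close>, whereas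
    \<open>D s0 = 0 \<le> C\<close> and \<open>D y \<le> C\<close>.\<close>
  obtain z where z: "z \<in> {s0..y}" "\<And>t. t \<in> {s0..y} \<Longrightarrow> D t \<le> D z"
    using continuous_attains_sup[of "{s0..y}" D] cont ys \<open>s0 < s1\<close> by auto
  have "C < D z" using z(2)[of s1] ys \<open>s0 < s1\<close> D by simp
  then have "z \<noteq> s0" "z \<noteq> y" using \<open>D y \<le> C\<close> \<open>D s0 = 0\<close> \<open>0 \<le> C\<close> by auto
  then have zs: "s0 < z" "z < y" using z by auto
  have z0: "D' z = 0"
    by (rule DERIV_local_max[OF deriv, of "min (z - s0) (y - z)"])
       (use zs z(2) in \<open>auto simp: abs_if split: if_splits\<close>)
  show False
  proof (cases "P = 0 \<and> Q = 0")
    case True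
    \<comment> \<open>Both terms are now shifts of one convex function, so \<open>D\<close> cannot
      decrease from \<open>z\<close> to \<open>y\<close>.\<close>
    obtain x where x: "D y - D z = (y - z) * D' x"
      using MVT2[OF zs(2), of D D'] deriv by blast
    have "0 \<le> D' x * b"
      using cost_ge_tangent[of 0 x "x + b"] cost_ge_tangent[of 0 "x + b" x] True
      by (simp add: D'_def algebra_simps)
    then have "0 \<le> (y - z) * D' x" using b zs by (simp add: zero_le_mult_iff)
    then show False using x \<open>D y \<le> C\<close> \<open>C < D z\<close> by simp
  next
    case False
    show False
      by (rule cost_gap_critical_point_unique[OF PQ False b zs(2)])
         (use le zs y0 z0 in \<open>auto simp: D'_def\<close>)
  qed
qed

text \<open>The gap is even and nonincreasing in the distance from the common foot, and the middle
  point is no farther from the foot than one of the outer points.\<close>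

lemma cost_gap_between_aligned:
  assumes PQ: "0 \<le> P" "0 \<le> Q" and "0 \<le> C" and s: "s1 < s2" "s2 < s3"
    and gap: "cost (s1\<^sup>2 + P) + C < cost (s1\<^sup>2 + Q)" "cost (s3\<^sup>2 + P) + C < cost (s3\<^sup>2 + Q)"
  shows "cost (s2\<^sup>2 + P) + C < cost (s2\<^sup>2 + Q)"
proof -
  define D where "D = (\<lambda>s. cost ((s + 0)\<^sup>2 + Q) - cost (s\<^sup>2 + P))"
  have "P < Q"
    using cost_mono[of "s1\<^sup>2 + Q" "s1\<^sup>2 + P"] PQ gap \<open>0 \<le> C\<close> by force
  have mono: "D t \<le> D s" if "0 \<le> s" "s \<le> t" for s t
  proof (rule DERIV_nonpos_imp_nonincreasing[OF that(2)])
    fix x assume "s \<le> x" "x \<le> t"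
    then have "slope (x\<^sup>2 + Q) * x \<le> slope (x\<^sup>2 + P) * x"
      using that PQ \<open>P < Q\<close> by (intro mult_right_mono slope_antimono) auto
    then show "\<exists>y. (D has_real_derivative y) (at x) \<and> y \<le> 0"
      using cost_gap_has_derivative[OF PQ, of 0 x] unfolding D_def by fastforce
  qed
  have even: "D \<bar>s\<bar> = D s" for s by (simp add: D_def)
  have "\<bar>s2\<bar> \<le> \<bar>s1\<bar> \<or> \<bar>s2\<bar> \<le> \<bar>s3\<bar>" using s by linarith
  then have "D s1 \<le> D s2 \<or> D s3 \<le> D s2"
    using mono[of "\<bar>s2\<bar>" "\<bar>s1\<bar>"] mono[of "\<bar>s2\<bar>" "\<bar>s3\<bar>"] by (auto simp: even)
  then show ?thesis using gap by (auto simp: D_def)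
qed

lemma is_interval_cost_gap:
  assumes "0 \<le> P" "0 \<le> Q" "0 \<le> C"
  shows "is_interval {t. cost ((t + a)\<^sup>2 + P) + C < cost ((t + b)\<^sup>2 + Q)}" (is "is_interval ?S")
proof -
  have "t2 \<in> ?S" if t: "t1 \<in> ?S" "t3 \<in> ?S" "t1 < t2" "t2 < t3" for t1 t2 t3
  proof (cases a b rule: linorder_cases)
    case less
    then show ?thesis
      using cost_gap_between_shifted[of P Q "b - a" C "t1 + a" "t2 + a" "t3 + a"] assms t by simp
  next
    case equal
    then show ?thesis
      using cost_gap_between_aligned[of P Q C "t1 + a" "t2 + a" "t3 + a"] assms t by simp
  next
    case greater
    \<comment> \<open>Reversing the orientation of the line makes the offset \<open>a - b\<close>
      positive.\<close>
    have flip: "(- t - a)\<^sup>2 = (t + a)\<^sup>2" "(- t - b)\<^sup>2 = (t + b)\<^sup>2" for t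
      by (simp_all add: power2_eq_square algebra_simps)
    show ?thesis
      using cost_gap_between_shifted[of P Q "a - b" C "- t3 - a" "- t2 - a" "- t1 - a"]
        assms t greater by (simp add: flip)
  qed
  then show ?thesis
    unfolding is_interval_1 by (metis (no_types, lifting) order_le_less)
qed

section \<open>The weighted distance equals the cost function\<close>

text \<open>Cauchy-Schwarz against the momentum vector of norm \<open>y\<close> with horizontal part
  \<open>\<mu>\<close>.\<close>

lemma layer_dual_bound:
  fixes N \<mu> a b :: point
  assumes "N \<bullet> N = 1" "N \<bullet> \<mu> = 0" "\<mu> \<bullet> \<mu> \<le> y\<^sup>2" "0 \<le> y"
  shows "\<mu> \<bullet> (b - a) + (N \<bullet> (b - a)) * sqrt (y\<^sup>2 - \<mu> \<bullet> \<mu>) \<le> y * dist a b"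
proof -
  define \<nu> where "\<nu> = \<mu> + sqrt (y\<^sup>2 - \<mu> \<bullet> \<mu>) *\<^sub>R N"
  have "\<nu> \<bullet> \<nu> = y\<^sup>2"
    using assms by (simp add: \<nu>_def inner_add_left inner_add_right inner_commute[of \<mu> N])
  then have "norm \<nu> = y" using assms by (simp add: norm_eq_sqrt_inner)
  then have "\<nu> \<bullet> (b - a) \<le> y * dist a b"
    using norm_cauchy_schwarz[of \<nu> "b - a"] by (simp add: dist_norm norm_minus_commute)
  then show ?thesis by (simp add: \<nu>_def inner_add_left mult.commute)
qed

text \<open>From below, one horizontal momentum \<open>\<mu>\<close> bounds all three segments of
  any path, and the bounds telescope to the cost. From above, the path refracted by Snell's law
  attains it.\<close>

lemma weighted_dist_eq_cost:
  fixes N p x :: point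
  assumes N: "N \<bullet> N = 1" and p: "N \<bullet> p = e - h" and x: "N \<bullet> x = e + H"
  shows "weighted_dist (plane N e) wm w wp p x = cost ((norm (x - p - (h + H) *\<^sub>R N))\<^sup>2)"
proof -
  define \<rho> u k Z where "\<rho> = x - p - (h + H) *\<^sub>R N" and "u = (norm \<rho>)\<^sup>2"
    and "k = slope u" and "Z = k\<^sup>2 * u"
  define \<mu> where "\<mu> = k *\<^sub>R \<rho>"
  have "N \<noteq> 0" using N by auto
  have N\<rho>: "N \<bullet> \<rho> = 0" using N p x by (simp add: \<rho>_def inner_diff_right)
  have "0 \<le> u" by (simp add: u_def)
  then have st: "0 < k" "Z \<le> w\<^sup>2" "Z < wm\<^sup>2" "Z < wp\<^sup>2" "k * drag Z \<le> 1" "k * drag Z = 1 \<or> Z = w\<^sup>2"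
    using stationary_slope[of u] by (auto simp: stationary_def k_def Z_def)
  have uu: "\<rho> \<bullet> \<rho> = u" by (simp add: u_def power2_norm_eq_inner)
  have \<mu>: "N \<bullet> \<mu> = 0" "\<mu> \<bullet> \<mu> = Z"
    using N\<rho> uu by (simp_all add: \<mu>_def Z_def power2_eq_square)
  have cost: "cost u = k * u + vertical_cost Z" by (simp add: cost_def k_def Z_def)
  have lower: "cost u \<le> path_cost wm w wp p a a1 x" if F: "a \<in> plane N e" "a1 \<in> plane N e" for a a1
  proof -
    have h: "N \<bullet> (a - p) = h" "N \<bullet> (x - a1) = H"
      using F p x by (auto simp: plane_def inner_diff_right)
    have "\<mu> \<bullet> (a - p) + h * sqrt (wm\<^sup>2 - Z) \<le> wm * dist p a"
      using layer_dual_bound[OF N \<mu>(1), of wm a p] \<mu> h st weight_bounds by simp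
    moreover have "\<mu> \<bullet> (x - a1) + H * sqrt (wp\<^sup>2 - Z) \<le> wp * dist a1 x"
      using layer_dual_bound[OF N \<mu>(1), of wp x a1] \<mu> h st weight_bounds by simp
    moreover have "\<mu> \<bullet> (a1 - a) \<le> w * dist a a1"
    proof -
      have "norm \<mu> \<le> w"
        using \<mu>(2) st(2) weight_bounds by (simp add: norm_eq_sqrt_inner real_le_lsqrt)
      then have "norm \<mu> * norm (a1 - a) \<le> w * norm (a1 - a)" by (intro mult_right_mono) auto
      then show ?thesis
        using norm_cauchy_schwarz[of \<mu> "a1 - a"] by (simp add: dist_norm norm_minus_commute)
    qed
    moreover have "\<mu> \<bullet> (a - p) + \<mu> \<bullet> (a1 - a) + \<mu> \<bullet> (x - a1) = \<mu> \<bullet> (x - p)"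
      by (simp add: inner_diff_right)
    moreover have "x - p = \<rho> + (h + H) *\<^sub>R N" by (simp add: \<rho>_def)
    then have "\<mu> \<bullet> (x - p) = k * u"
      using \<mu>(1) uu by (simp add: inner_add_right inner_commute[of \<mu> N]) (simp add: \<mu>_def)
    ultimately show ?thesis unfolding cost vertical_cost_def path_cost_def by linarith
  qed
  define X Y where "X = sqrt (wm\<^sup>2 - Z)" and "Y = sqrt (wp\<^sup>2 - Z)"
  have XY: "0 < X" "0 < Y" "X\<^sup>2 = wm\<^sup>2 - Z" "Y\<^sup>2 = wp\<^sup>2 - Z" using st by (auto simp: X_def Y_def)
  \<comment> \<open>The rays from \<open>p\<close> upwards and from \<open>x\<close> downwards along
    the momentum directions, cut off where they meet the plane.\<close>
  define a a1 where "a = p + (h / X) *\<^sub>R (\<mu> + X *\<^sub>R N)" and "a1 = x - (H / Y) *\<^sub>R (\<mu> + Y *\<^sub>R N)"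
  have F: "a \<in> plane N e" "a1 \<in> plane N e"
    using N p x \<mu>(1) XY
    by (auto simp: a_def a1_def plane_def inner_add_right inner_diff_right)
  have norm: "norm (\<mu> + y *\<^sub>R N) = c" if "y\<^sup>2 = c\<^sup>2 - Z" "0 < c" for y c
  proof -
    have "(\<mu> + y *\<^sub>R N) \<bullet> (\<mu> + y *\<^sub>R N) = Z + y\<^sup>2"
      using N \<mu> by (simp add: inner_add_left inner_add_right inner_commute[of \<mu> N] power2_eq_square)
    then show ?thesis using that by (simp add: norm_eq_sqrt_inner)
  qed
  have "dist p a = h / X * wm" "dist a1 x = H / Y * wp"
    using norm[of X wm] norm[of Y wp] XY heights weight_bounds
    by (auto simp: a_def a1_def dist_norm)
  \<comment> \<open>The segment in the plane covers the rest of \<open>\<rho>\<close>; either it is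
    trivial or the momentum \<open>k * sqrt u\<close> equals \<open>w\<close>.\<close>
  moreover have "w * dist a a1 = k * u * (1 - k * drag Z)"
  proof -
    have "a1 - a = \<rho> - (h / X + H / Y) *\<^sub>R \<mu>"
      using XY by (simp add: a_def a1_def \<rho>_def algebra_simps)
    also have "\<dots> = (1 - k * drag Z) *\<^sub>R \<rho>"
      by (simp add: \<mu>_def drag_def X_def Y_def algebra_simps)
    finally have "dist a a1 = (1 - k * drag Z) * sqrt u"
      using st(5) by (simp add: dist_norm norm_minus_commute u_def)
    moreover have "w = k * sqrt u" if "k * drag Z \<noteq> 1"
    proof -
      have "w\<^sup>2 = (k * sqrt u)\<^sup>2" using that st(6) \<open>0 \<le> u\<close> by (simp add: Z_def power_mult_distrib)
      then show ?thesis using st(1) \<open>0 \<le> u\<close> weight_bounds by (simp add: power2_eq_iff_nonneg)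
    qed
    ultimately show ?thesis using \<open>0 \<le> u\<close> by (cases "k * drag Z = 1") auto
  qed
  ultimately have "path_cost wm w wp p a a1 x
      = h * (wm\<^sup>2 / X) + H * (wp\<^sup>2 / Y) + k * u - Z * (h / X + H / Y)"
    by (simp add: path_cost_def drag_def X_def Y_def Z_def power2_eq_square algebra_simps)
  also have "\<dots> = k * u + h * ((wm\<^sup>2 - Z) / X) + H * ((wp\<^sup>2 - Z) / Y)"
    by (simp add: algebra_simps diff_divide_distrib)
  also have "\<dots> = cost u"
    unfolding cost vertical_cost_def X_def[symmetric] Y_def[symmetric] XY(3,4)[symmetric]
    using XY(1,2) by (simp add: power2_eq_square)
  finally have "path_cost wm w wp p a a1 x = cost u" .
  then have "weighted_dist (plane N e) wm w wp p x \<le> cost u"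
    using weighted_dist_is_min(2)[OF \<open>N \<noteq> 0\<close> weights F] by metis
  moreover have "cost u \<le> weighted_dist (plane N e) wm w wp p x"
    using weighted_dist_is_min(1)[OF \<open>N \<noteq> 0\<close> weights] lower by metis
  ultimately show ?thesis by (simp add: u_def \<rho>_def)
qed

end

section \<open>Reduction of the geometric statement to one real parameter\<close>

text \<open>Turns equal distances from the plane into equal heights; the foot of the perpendicular
  attains the bound given by Cauchy-Schwarz.\<close>

lemma infdist_plane:
  fixes N p :: point
  assumes "N \<bullet> N = 1" "N \<bullet> p \<le> e"
  shows "infdist p (plane N e) = e - N \<bullet> p"
proof (rule antisym)
  have "norm N = 1" using assms by (simp add: norm_eq_1)
  define f where "f = p + (e - N \<bullet> p) *\<^sub>R N"
  have f: "f \<in> plane N e" using assms by (simp add: f_def plane_def inner_add_right)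
  then show "infdist p (plane N e) \<le> e - N \<bullet> p"
    using infdist_le[OF f, of p] assms \<open>norm N = 1\<close> by (simp add: f_def dist_norm)
  have "e - N \<bullet> p \<le> dist p a" if "a \<in> plane N e" for a
    using norm_cauchy_schwarz[of N "a - p"] that \<open>norm N = 1\<close>
    by (simp add: plane_def inner_diff_right dist_norm norm_minus_commute)
  then show "e - N \<bullet> p \<le> infdist p (plane N e)"
    using f by (subst infdist_notempty) (auto intro!: cINF_greatest)
qed

lemma plane_normalized: "n \<noteq> 0 \<Longrightarrow> plane n d = plane (n /\<^sub>R norm n) (d / norm n)"
  and lower_normalized: "n \<noteq> 0 \<Longrightarrow> lower n d = lower (n /\<^sub>R norm n) (d / norm n)"
  and upper_normalized: "n \<noteq> 0 \<Longrightarrow> upper n d = upper (n /\<^sub>R norm n) (d / norm n)"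
  by (auto simp: plane_def lower_def upper_def field_simps)

lemma line_parametrization:
  assumes "is_line l"
  obtains q u where "norm u = 1" "l = range (\<lambda>t. q + t *\<^sub>R u)"
proof -
  obtain B where B: "affine hull B = affine hull l" "of_nat (card B) = aff_dim l + 1"
    using aff_dim_basis_exists by blast
  have l: "affine hull l = l" "aff_dim l = 1"
    using assms by (auto simp: is_line_def affine_hull_eq)
  then have "card B = 2" using B by simp
  then obtain a b where ab: "B = {a, b}" "a \<noteq> b" by (auto simp: card_2_iff)
  have l_eq: "l = range (\<lambda>t. a + t *\<^sub>R (b - a))" using B l ab affine_hull_2_alt by metis
  define u where "u = (b - a) /\<^sub>R norm (b - a)"
  have ba: "b - a = norm (b - a) *\<^sub>R u" using ab by (simp add: u_def)
  have "range (\<lambda>t. a + t *\<^sub>R (b - a)) = range (\<lambda>t. a + t *\<^sub>R u)"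
  proof (intro subset_antisym image_subsetI)
    fix t
    have "a + t *\<^sub>R (b - a) = a + (t * norm (b - a)) *\<^sub>R u"
      using ab by (simp add: u_def)
    then show "a + t *\<^sub>R (b - a) \<in> range (\<lambda>t. a + t *\<^sub>R u)" by (rule range_eqI)
  next
    fix t
    have "a + t *\<^sub>R u = a + (t / norm (b - a)) *\<^sub>R (b - a)" by (simp add: u_def divide_inverse)
    then show "a + t *\<^sub>R u \<in> range (\<lambda>t. a + t *\<^sub>R (b - a))" by (rule range_eqI)
  qed
  then have "l = range (\<lambda>t. a + t *\<^sub>R u)" using l_eq by simp
  moreover have "norm u = 1" using ab by (simp add: u_def)
  ultimately show ?thesis using that by blast
qed

lemma inner_constant_on_parallel_line:
  assumes "line_parallel_to_plane l (plane N e)" "x \<in> l" "y \<in> l"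
  shows "N \<bullet> x = N \<bullet> y"
proof -
  obtain a where "(+) a ` l \<subseteq> plane N e"
    using assms(1) by (auto simp: line_parallel_to_plane_def affine_parallel_def)
  then have "N \<bullet> (a + x) = e" "N \<bullet> (a + y) = e" using assms by (auto simp: plane_def)
  then show ?thesis by (simp add: inner_add_right)
qed

text \<open>Pythagoras: the part independent of \<open>t\<close> is the squared distance from the
  origin to the line.\<close>

lemma norm_along_line:
  fixes r u :: point
  assumes "norm u = 1"
  shows "(norm (r + t *\<^sub>R u))\<^sup>2 = (t + r \<bullet> u)\<^sup>2 + (r \<bullet> r - (r \<bullet> u)\<^sup>2)"
    and "0 \<le> r \<bullet> r - (r \<bullet> u)\<^sup>2"
proof -
  have "u \<bullet> u = 1" using assms by (simp add: norm_eq_1)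
  then show "(norm (r + t *\<^sub>R u))\<^sup>2 = (t + r \<bullet> u)\<^sup>2 + (r \<bullet> r - (r \<bullet> u)\<^sup>2)"
    unfolding power2_norm_eq_inner
    by (simp add: inner_add_left inner_add_right inner_commute[of u r] power2_eq_square algebra_simps)
  show "0 \<le> r \<bullet> r - (r \<bullet> u)\<^sup>2"
    using Cauchy_Schwarz_ineq[of r u] \<open>u \<bullet> u = 1\<close> by simp
qed

theorem theorem2p1:
  fixes n v v' :: point and d wm w wp C :: real and l :: "point set"
  assumes "n \<noteq> 0"
    and "admissible_weights wm w wp"
    and "v \<in> lower n d" and "v' \<in> lower n d"
    and "infdist v (plane n d) = infdist v' (plane n d)"
    and "is_line l" and "l \<subseteq> upper n d" and "line_parallel_to_plane l (plane n d)"
    and "C \<ge> 0"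
  shows "interval_on_line l (voronoi_cell (plane n d) wm w wp v v' l C)"
proof -
  \<comment> \<open>With a unit normal, \<open>N \<bullet> x - e\<close> is the signed height over
    the plane.\<close>
  define N e where "N = n /\<^sub>R norm n" and "e = d / norm n"
  note normalized = plane_normalized[OF assms(1), of d, folded N_def e_def]
    lower_normalized[OF assms(1), of d, folded N_def e_def]
    upper_normalized[OF assms(1), of d, folded N_def e_def]
  note asms = assms(3-)[unfolded normalized]
  have "norm N = 1" using assms(1) by (simp add: N_def)
  then have N: "N \<bullet> N = 1" by (simp add: norm_eq_1)
  obtain q u where u: "norm u = 1" and l: "l = range (\<lambda>t. q + t *\<^sub>R u)"
    using line_parametrization[OF asms(4)] by blast
  define h H where "h = e - N \<bullet> v" and "H = N \<bullet> q - e"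
  have "N \<bullet> v < e" "N \<bullet> v' < e" using asms by (auto simp: lower_def)
  then have v: "N \<bullet> v = e - h" "N \<bullet> v' = e - h" "0 < h"
    using infdist_plane[OF N, of v e] infdist_plane[OF N, of v' e] asms(3) by (auto simp: h_def)
  have on_l: "q + t *\<^sub>R u \<in> l" for t by (auto simp: l)
  have "q \<in> l" using on_l[of 0] by simp
  then have "e < N \<bullet> q" using asms(5) by (auto simp: upper_def)
  then have "0 < H" by (simp add: H_def)
  have height: "N \<bullet> (q + t *\<^sub>R u) = e + H" for t
    using inner_constant_on_parallel_line[OF asms(6) on_l \<open>q \<in> l\<close>, of t] by (simp add: H_def)
  interpret two_media h H wm w wp
    by unfold_locales (use v \<open>0 < H\<close> assms(2) in auto)
  \<comment> \<open>The horizontal displacement from a site \<open>p\<close> to the base point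
    \<open>q\<close>; both sites share the depth \<open>h\<close>, hence the same
    \<open>cost\<close> function.\<close>
  define r where "r p = q - p - (h + H) *\<^sub>R N" for p
  have dist: "weighted_dist (plane N e) wm w wp p (q + t *\<^sub>R u)
      = cost ((t + r p \<bullet> u)\<^sup>2 + (r p \<bullet> r p - (r p \<bullet> u)\<^sup>2))" if "N \<bullet> p = e - h" for p t
  proof -
    have "q + t *\<^sub>R u - p - (h + H) *\<^sub>R N = r p + t *\<^sub>R u" by (simp add: r_def)
    then show ?thesis
      using weighted_dist_eq_cost[OF N that height[of t]] norm_along_line(1)[OF u, of "r p" t]
      by (simp only:)
  qed
  define I where "I = {t. cost ((t + r v \<bullet> u)\<^sup>2 + (r v \<bullet> r v - (r v \<bullet> u)\<^sup>2)) + C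
      < cost ((t + r v' \<bullet> u)\<^sup>2 + (r v' \<bullet> r v' - (r v' \<bullet> u)\<^sup>2))}"
  have "is_interval I"
    unfolding I_def by (intro is_interval_cost_gap norm_along_line(2) u assms(9))
  moreover have "voronoi_cell (plane n d) wm w wp v v' l C = (\<lambda>t. q + t *\<^sub>R u) ` I"
    unfolding voronoi_cell_def normalized l I_def by (auto simp: dist v)
  moreover have "u \<noteq> 0" using u by auto
  ultimately show ?thesis unfolding interval_on_line_def using l by blast
qed

end
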